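(* Let $k\ge r\ge1$ be integers and let a quadrature formula on $[0,1]$ with $k$ distinct abscissae $c_1,\dots,c_k\in[0,1]$ and weights $b_1,\dots,b_k$ have order $q\ge k$, i.e. be exact for all polynomials of degree less than $q$. Consider the one-step method for $y'=f(y)$, $y(t_0)=y_0$, given by $y_1=u(t_0+h)$, where $u$ is the polynomial of degree at most $r$ with $u(t_0)=y_0$ and $$u'(t_0+c_ih)=\sum_{j=0}^{r-1}\hat P_j(c_i)\sum_{\ell=1}^k b_\ell\hat P_j(c_\ell) f(u(t_0+c_\ell h)),\qquad i=1,\dots,k .$$ If $q\ge 2r$, then the method is perfectly $A$-stable, i.e. its absolute stability region coincides with the left half complex plane $\mathbb{C}^-=\{z\in\mathbb{C}:\Re(z)<0\}$.
   Context: $\{\hat P_j\}_{j\ge 0}$ are the shifted Legendre polynomials on $[0,1]$, scaled to be orthonormal: $\deg \hat P_j=j$ and $\int_0^1 \hat P_i(x)\hat P_j(x)\,\mathrm{d}x=\delta_{ij}$ for all $i,j\ge 0$. Absolute stability region: applied with stepsize $h$ to the test equation $y'=\lambda y$, $\lambda\in\mathbb{C}$, the method gives $y_1=R(z)y_0$ with $z=h\lambda$, for all $z$ for which $u$ is uniquely determined; the absolute stability region is the set of those $z$ with $|R(z)|<1$. *)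

theory Defs
  imports "HOL-Analysis.Analysis" "HOL-Computational_Algebra.Polynomial"
begin

(* The two conditions determine the family up to the sign of each member; the method below
   only involves products of two values of the same P j, so it does not depend on the signs. *)
definition orthonormal_shifted_legendre :: "(nat \<Rightarrow> real poly) \<Rightarrow> bool" where
  "orthonormal_shifted_legendre P \<longleftrightarrow>
     (\<forall>j. degree (P j) = j) \<and>
     (\<forall>i j. integral {0..1} (\<lambda>x. poly (P i) x * poly (P j) x) = (if i = j then 1 else 0))"

(* Order at least q: exactness for all polynomials of degree less than q.  The nodes c and the
   weights b are indexed by 1, ..., k. *)
definition quadrature_order :: "nat \<Rightarrow> (nat \<Rightarrow> real) \<Rightarrow> (nat \<Rightarrow> real) \<Rightarrow> nat \<Rightarrow> bool" where
  "quadrature_order k c b q \<longleftrightarrow>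
     (\<forall>p :: real poly. degree p < q \<longrightarrow>
        (\<Sum>i=1..k. b i * poly p (c i)) = integral {0..1} (\<lambda>x. poly p x))"

(* u is a polynomial with complex coefficients in the real time variable t; the values at real
   times are poly u (of_real t), and pderiv u is the derivative with respect to t. *)
definition method_polynomial ::
  "(nat \<Rightarrow> real poly) \<Rightarrow> nat \<Rightarrow> nat \<Rightarrow> (nat \<Rightarrow> real) \<Rightarrow> (nat \<Rightarrow> real) \<Rightarrow>
   (complex \<Rightarrow> complex) \<Rightarrow> real \<Rightarrow> complex \<Rightarrow> real \<Rightarrow> complex poly \<Rightarrow> bool" where
  "method_polynomial P k r c b f t0 y0 h u \<longleftrightarrow>
     degree u \<le> r \<and>
     poly u (of_real t0) = y0 \<and>
     (\<forall>i\<in>{1..k}. poly (pderiv u) (of_real (t0 + c i * h)) =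
        (\<Sum>j<r. of_real (poly (P j) (c i)) *
           (\<Sum>l=1..k. of_real (b l * poly (P j) (c l)) * f (poly u (of_real (t0 + c l * h))))))"

definition uniquely_determined ::
  "(nat \<Rightarrow> real poly) \<Rightarrow> nat \<Rightarrow> nat \<Rightarrow> (nat \<Rightarrow> real) \<Rightarrow> (nat \<Rightarrow> real) \<Rightarrow> complex \<Rightarrow> bool" where
  "uniquely_determined P k r c b z \<longleftrightarrow>
     (\<forall>t0 y0 h \<mu>. h > 0 \<and> z = of_real h * \<mu> \<longrightarrow>
        (\<exists>!u. method_polynomial P k r c b (\<lambda>y. \<mu> * y) t0 y0 h u))"

(* R is the value at z of the stability function; at points z where u is uniquely determined
   there is at most one such R (take y0 = 1). *)
definition stability_value ::
  "(nat \<Rightarrow> real poly) \<Rightarrow> nat \<Rightarrow> nat \<Rightarrow> (nat \<Rightarrow> real) \<Rightarrow> (nat \<Rightarrow> real) \<Rightarrow>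
   complex \<Rightarrow> complex \<Rightarrow> bool" where
  "stability_value P k r c b z R \<longleftrightarrow>
     (\<forall>t0 y0 h \<mu> u. h > 0 \<and> z = of_real h * \<mu> \<and>
        method_polynomial P k r c b (\<lambda>y. \<mu> * y) t0 y0 h u \<longrightarrow>
        poly u (of_real (t0 + h)) = R * y0)"

definition absolute_stability_region ::
  "(nat \<Rightarrow> real poly) \<Rightarrow> nat \<Rightarrow> nat \<Rightarrow> (nat \<Rightarrow> real) \<Rightarrow> (nat \<Rightarrow> real) \<Rightarrow> complex set" where
  "absolute_stability_region P k r c b =
     {z. uniquely_determined P k r c b z \<and>
         (\<exists>R. stability_value P k r c b z R \<and> norm R < 1)}"

definition perfectly_A_stable ::
  "(nat \<Rightarrow> real poly) \<Rightarrow> nat \<Rightarrow> nat \<Rightarrow> (nat \<Rightarrow> real) \<Rightarrow> (nat \<Rightarrow> real) \<Rightarrow> bool" where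
  "perfectly_A_stable P k r c b \<longleftrightarrow>
     absolute_stability_region P k r c b = {z. Re z < 0}"

end

theory Submission
  imports Defs
begin

text \<open>
  In the variable \<open>s = (t - t\<^sub>0) / h\<close> the method is about a polynomial \<open>w\<close> of degree at most
  \<open>r\<close>. For the test equation the right-hand side is \<open>z\<close> times a discrete Legendre projection of
  \<open>w\<close>. The quadrature is exact in degrees below \<open>2 r\<close>, hence for all products of \<open>w\<close> with
  \<open>P\<^sub>j\<close>, \<open>j < r\<close>, so this is the orthogonal projection of \<open>w\<close> onto degrees below \<open>r\<close>: it removes
  from \<open>w\<close> exactly its \<open>P\<^sub>r\<close> component. Both sides of the collocation equations have degree less
  than \<open>r \<le> k\<close> and agree at \<open>k\<close> points, so the method amounts to the identity
  \<open>w' = z (w - a P\<^sub>r)\<close> for some \<open>a\<close> (\<open>unit_step_iff\<close>).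

  Multiplying by \<open>cnj z \<cdot> cnj w'\<close>, taking real parts and integrating kills the term with \<open>P\<^sub>r\<close>, because \<open>w'\<close>
  has degree less than \<open>r\<close>. As \<open>2 Re (w \<cdot> cnj w')\<close> is the derivative of \<open>|w|\<^sup>2\<close>, what remains is
  the identity (\<open>energy_identity\<close>)
  \<open>2 Re z \<cdot> \<integral>|w'|\<^sup>2 = |z|\<^sup>2 (|w(1)|\<^sup>2 - |w(0)|\<^sup>2)\<close>.
  So \<open>|R(z)| < 1\<close> in the open left half plane and \<open>|R(z)| \<ge> 1\<close> wherever \<open>Re z \<ge> 0\<close> and \<open>u\<close> exists.

  The same identity gives unique solvability for \<open>Re z < 0\<close>: a solution that vanishes at \<open>0\<close> is
  zero, and a nonzero solution can be written down, namely \<open>\<Sum>\<^sub>n z\<^sup>-\<^sup>n D\<^sup>n P\<^sub>r\<close>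
  (\<open>nonzero_solution_exists\<close>), and scaled to any initial value.
\<close>

section \<open>Real polynomials as complex polynomials\<close>

abbreviation complex_poly :: "real poly \<Rightarrow> complex poly" where
  "complex_poly \<equiv> map_poly of_real"

lemma poly_complex_poly [simp]: "poly (complex_poly p) (of_real x) = of_real (poly p x)"
  by (induction p) (simp_all add: map_poly_pCons)

lemma degree_complex_poly [simp]: "degree (complex_poly p) = degree p"
  by (rule degree_map_poly) simp

lemma complex_poly_eq_0_iff [simp]: "complex_poly p = 0 \<longleftrightarrow> p = 0"
  by (rule map_poly_eq_0_iff) simp_all

section \<open>Expansion in the orthonormal family\<close>

lemma orthonormal_shifted_legendre_nonzero:
  assumes "orthonormal_shifted_legendre P"
  shows "P j \<noteq> 0"
proof
  assume "P j = 0"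
  moreover have "integral {0..1} (\<lambda>x. poly (P j) x * poly (P j) x) = 1"
    using assms by (simp add: orthonormal_shifted_legendre_def)
  ultimately show False by simp
qed

lemma graded_expansion:
  fixes P :: "nat \<Rightarrow> real poly" and p :: "complex poly"
  assumes deg: "\<And>j. degree (P j) = j" and nz: "\<And>j. P j \<noteq> 0"
    and "\<And>i. n \<le> i \<Longrightarrow> coeff p i = 0"
  shows "\<exists>\<alpha>. p = (\<Sum>j<n. smult (\<alpha> j) (complex_poly (P j)))"
  using assms(3)
proof (induction n arbitrary: p)
  case 0
  then show ?case by (simp add: poly_eq_iff)
next
  case (Suc n)
  let ?L = "complex_poly (P n)"
  define a where "a = coeff p n / coeff ?L n"
  have L: "coeff ?L n \<noteq> 0"
    using nz[of n] deg[of n] degree_complex_poly[of "P n"] complex_poly_eq_0_iff[of "P n"]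
    by (metis leading_coeff_0_iff)
  have "coeff (p - smult a ?L) i = 0" if "n \<le> i" for i
  proof (cases "i = n")
    case True
    then show ?thesis using L by (simp add: a_def)
  next
    case False
    then have "Suc n \<le> i" using that by simp
    moreover from this have "coeff ?L i = 0"
      by (intro coeff_eq_0) (simp add: deg)
    ultimately show ?thesis using Suc.prems by simp
  qed
  from Suc.IH[OF this] obtain \<alpha> where
    \<alpha>: "p - smult a ?L = (\<Sum>j<n. smult (\<alpha> j) (complex_poly (P j)))" by blast
  have "p = (\<Sum>j<Suc n. smult ((\<alpha>(n := a)) j) (complex_poly (P j)))"
    using \<alpha> by (simp add: algebra_simps)
  then show ?case by blast
qed

lemma legendre_expansion:
  fixes p :: "complex poly"
  assumes "orthonormal_shifted_legendre P" and "degree p < n"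
  obtains \<alpha> where "p = (\<Sum>j<n. smult (\<alpha> j) (complex_poly (P j)))"
proof -
  have "\<exists>\<alpha>. p = (\<Sum>j<n. smult (\<alpha> j) (complex_poly (P j)))"
  proof (rule graded_expansion)
    show "degree (P j) = j" for j
      using assms(1) by (simp add: orthonormal_shifted_legendre_def)
    show "P j \<noteq> 0" for j
      by (rule orthonormal_shifted_legendre_nonzero[OF assms(1)])
    show "coeff p i = 0" if "n \<le> i" for i
      using that assms(2) by (intro coeff_eq_0) simp
  qed
  then show ?thesis using that by blast
qed

section \<open>The method as a perturbed differential equation\<close>

lemma discrete_orthonormality:
  assumes "orthonormal_shifted_legendre P" and "quadrature_order k c b q" and "i + j < q"
  shows "(\<Sum>l=1..k. b l * poly (P i) (c l) * poly (P j) (c l)) = (if i = j then 1 else 0)"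
proof -
  have d: "degree (P i) = i" "degree (P j) = j"
    using assms(1) by (simp_all add: orthonormal_shifted_legendre_def)
  have "degree (P i * P j) < q"
    using degree_mult_le[of "P i" "P j"] d assms(3) by simp
  then have "(\<Sum>l=1..k. b l * poly (P i * P j) (c l)) = integral {0..1} (\<lambda>x. poly (P i * P j) x)"
    using assms(2) by (auto simp: quadrature_order_def)
  also have "\<dots> = (if i = j then 1 else 0)"
    using assms(1) by (simp add: orthonormal_shifted_legendre_def)
  finally show ?thesis by (simp add: mult.assoc)
qed

text \<open>
  This is where \<open>2 r \<le> q\<close> enters: for \<open>j < r\<close> and \<open>i \<le> r\<close> the product \<open>P\<^sub>i P\<^sub>j\<close> has degree at
  most \<open>2 r - 1 < q\<close>, so the quadrature recovers the Legendre coefficients of \<open>w\<close> below the index \<open>r\<close>, even though it need not be exact for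
  \<open>P\<^sub>r\<^sup>2\<close>.
\<close>

lemma discrete_projection:
  fixes w :: "complex poly"
  assumes P: "orthonormal_shifted_legendre P" and Q: "quadrature_order k c b q"
    and q: "2 * r \<le> q" and w: "degree w \<le> r"
  obtains a where
    "w - smult a (complex_poly (P r)) =
      (\<Sum>j<r. smult (\<Sum>l=1..k. of_real (b l * poly (P j) (c l)) * poly w (of_real (c l)))
               (complex_poly (P j)))"
proof -
  obtain \<alpha> where \<alpha>: "w = (\<Sum>j<Suc r. smult (\<alpha> j) (complex_poly (P j)))"
    using legendre_expansion[OF P, of w "Suc r"] w by auto
  have "(\<Sum>l=1..k. of_real (b l * poly (P j) (c l)) * poly w (of_real (c l))) = \<alpha> j"
    if j: "j < r" for j
  proof -
    have "(\<Sum>l=1..k. of_real (b l * poly (P j) (c l)) * poly w (of_real (c l)))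
        = (\<Sum>l=1..k. \<Sum>i<Suc r. \<alpha> i * of_real (b l * poly (P j) (c l) * poly (P i) (c l)))"
      by (subst \<alpha>) (simp only: poly_sum poly_smult poly_complex_poly sum_distrib_left
          of_real_mult mult_ac)
    also have "\<dots> = (\<Sum>i<Suc r. \<Sum>l=1..k. \<alpha> i * of_real (b l * poly (P j) (c l) * poly (P i) (c l)))"
      by (rule sum.swap)
    also have "\<dots> = (\<Sum>i<Suc r. \<alpha> i * of_real (\<Sum>l=1..k. b l * poly (P j) (c l) * poly (P i) (c l)))"
      by (simp only: of_real_sum sum_distrib_left)
    also have "\<dots> = (\<Sum>i<Suc r. \<alpha> i * of_real (if j = i then 1 else 0))"
      using j q by (intro sum.cong refl arg_cong2[of _ _ _ _ "(*)"] arg_cong[of _ _ of_real]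
          discrete_orthonormality[OF P Q]) auto
    also have "\<dots> = (\<Sum>i<Suc r. if j = i then \<alpha> i else 0)"
      by (intro sum.cong) auto
    also have "\<dots> = \<alpha> j"
      using j by simp
    finally show ?thesis .
  qed
  then have "(\<Sum>j<r. smult (\<Sum>l=1..k. of_real (b l * poly (P j) (c l)) * poly w (of_real (c l)))
               (complex_poly (P j))) = (\<Sum>j<r. smult (\<alpha> j) (complex_poly (P j)))"
    by (intro sum.cong) auto
  also have "\<dots> = w - smult (\<alpha> r) (complex_poly (P r))"
    by (subst \<alpha>) simp
  finally show ?thesis using that by metis
qed

text \<open>
  The term \<open>a P\<^sub>r\<close> is a defect in the test equation \<open>w' = z w\<close>, which for \<open>z \<noteq> 0\<close> has no nonzero
  polynomial solution. Leaving \<open>a\<close> free makes the solutions a linear space.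
\<close>

definition legendre_perturbed_solution ::
  "(nat \<Rightarrow> real poly) \<Rightarrow> nat \<Rightarrow> complex \<Rightarrow> complex poly \<Rightarrow> bool" where
  "legendre_perturbed_solution P r z w \<longleftrightarrow>
     degree w \<le> r \<and> (\<exists>a. pderiv w = smult z (w - smult a (complex_poly (P r))))"

lemma degree_pderiv_less:
  fixes w :: "complex poly"
  assumes "degree w \<le> r" and "1 \<le> r"
  shows "degree (pderiv w) < r"
  using assms by (simp add: degree_pderiv)

text \<open>
  If \<open>z \<noteq> 0\<close>, the degree of \<open>w'\<close> forces \<open>a\<close> to be the \<open>P\<^sub>r\<close> coefficient of \<open>w\<close>, so the existential
  quantifier over \<open>a\<close> loses nothing; if \<open>z = 0\<close>, both conditions say \<open>w' = 0\<close>.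
\<close>

lemma unit_step_iff:
  fixes w :: "complex poly"
  assumes P: "orthonormal_shifted_legendre P" and Q: "quadrature_order k c b q"
    and q: "2 * r \<le> q" and r: "1 \<le> r" "r \<le> k" and inj: "inj_on c {1..k}"
  shows "method_polynomial P k r c b (\<lambda>y. z * y) 0 y0 1 w \<longleftrightarrow>
         legendre_perturbed_solution P r z w \<and> poly w 0 = y0"
proof (cases "degree w \<le> r")
  case False
  then show ?thesis by (simp add: method_polynomial_def legendre_perturbed_solution_def)
next
  case True
  let ?L = "\<lambda>j. complex_poly (P j)"
  define \<pi> where "\<pi> = (\<Sum>j<r. smult (\<Sum>l=1..k. of_real (b l * poly (P j) (c l)) * poly w (of_real (c l)))
               (?L j))"
  obtain a where a: "w - smult a (?L r) = \<pi>"
    using discrete_projection[OF P Q q True] unfolding \<pi>_def by blast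
  have degP: "degree (P j) = j" for j
    using P by (simp add: orthonormal_shifted_legendre_def)
  have deg\<pi>: "degree \<pi> < r"
    unfolding \<pi>_def using r(1)
    by (intro degree_sum_less) (auto intro: le_less_trans[OF degree_smult_le] simp: degP)
  have degw': "degree (pderiv w) < r"
    using degree_pderiv_less True r(1) by blast
  have rhs: "(\<Sum>j<r. of_real (poly (P j) x) *
           (\<Sum>l=1..k. of_real (b l * poly (P j) (c l)) * (z * poly w (of_real (c l)))))
       = poly (smult z \<pi>) (of_real x)" for x
    by (simp add: \<pi>_def poly_sum sum_distrib_left mult_ac)
  let ?N = "(\<lambda>i. complex_of_real (c i)) ` {1..k}"
  have "inj_on (\<lambda>i. complex_of_real (c i)) {1..k}"
    using inj unfolding inj_on_def of_real_eq_iff .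
  then have nodes: "card ?N = k"
    by (simp add: card_image)
  have collocation: "(\<forall>i\<in>{1..k}. poly (pderiv w) (of_real (c i)) = poly (smult z \<pi>) (of_real (c i)))
      \<longleftrightarrow> pderiv w = smult z \<pi>"
  proof
    assume *: "\<forall>i\<in>{1..k}. poly (pderiv w) (of_real (c i)) = poly (smult z \<pi>) (of_real (c i))"
    have "degree (smult z \<pi>) < r"
      using deg\<pi> by (rule le_less_trans[OF degree_smult_le])
    then have "degree (pderiv w) < card ?N" "degree (smult z \<pi>) < card ?N"
      using degw' r(2) unfolding nodes by linarith+
    with * show "pderiv w = smult z \<pi>"
      by (intro poly_eqI_degree[of ?N]) blast+
  next
    assume "pderiv w = smult z \<pi>"
    then show "\<forall>i\<in>{1..k}. poly (pderiv w) (of_real (c i)) = poly (smult z \<pi>) (of_real (c i))"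
      by (simp only:) blast
  qed
  have perturbed: "pderiv w = smult z \<pi> \<longleftrightarrow> (\<exists>a. pderiv w = smult z (w - smult a (?L r)))"
  proof
    assume "\<exists>a. pderiv w = smult z (w - smult a (?L r))"
    then obtain a' where a': "pderiv w = smult z (w - smult a' (?L r))" by blast
    show "pderiv w = smult z \<pi>"
    proof (cases "z = 0")
      case False
      have "a' = a"
      proof (rule ccontr)
        assume "a' \<noteq> a"
        have "smult (z * (a - a')) (?L r) = pderiv w - smult z \<pi>"
          unfolding a' a[symmetric] by (simp add: smult_diff_right smult_diff_left right_diff_distrib)
        moreover have "degree (pderiv w - smult z \<pi>) < r"
          using degw' le_less_trans[OF degree_smult_le deg\<pi>] by (rule degree_diff_less)
        moreover have "degree (smult (z * (a - a')) (?L r)) = r"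
          using False \<open>a' \<noteq> a\<close> degP[of r] by simp
        ultimately show False by simp
      qed
      then show ?thesis using a' unfolding a[symmetric] by (simp only:)
    next
      case True
      then show ?thesis using a' by (simp only: smult_0_left)
    qed
  next
    assume "pderiv w = smult z \<pi>"
    then show "\<exists>a. pderiv w = smult z (w - smult a (?L r))"
      unfolding a[symmetric] by (rule exI)
  qed
  show ?thesis
    unfolding method_polynomial_def legendre_perturbed_solution_def rhs add_0 mult_1_right of_real_0
      collocation perturbed[symmetric]
    using True by (simp only: simp_thms conj_commute)
qed

section \<open>Energy identity\<close>

text \<open>
  After taking the real part, the complex coefficients \<open>\<alpha>\<^sub>j\<close> of \<open>p\<close> enter only through the real
  factors \<open>Re (a \<cdot> cnj \<alpha>\<^sub>j)\<close> of the real integrals \<open>\<integral>P\<^sub>r P\<^sub>j\<close>.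
\<close>

lemma integral_orthogonal:
  fixes p :: "complex poly"
  assumes P: "orthonormal_shifted_legendre P" and deg: "degree p < r"
  shows "((\<lambda>x. Re (a * of_real (poly (P r) x) * cnj (poly p (of_real x)))) has_integral 0) {0..1}"
proof -
  obtain \<alpha> where \<alpha>: "p = (\<Sum>j<r. smult (\<alpha> j) (complex_poly (P j)))"
    using legendre_expansion[OF P deg] .
  have "((\<lambda>x. poly (P r) x * poly (P j) x) has_integral 0) {0..1}" if "j < r" for j
  proof -
    have "(\<lambda>x. poly (P r) x * poly (P j) x) integrable_on {0..1}"
      by (intro integrable_continuous_real continuous_intros)
    moreover have "integral {0..1} (\<lambda>x. poly (P r) x * poly (P j) x) = 0"
      using P that by (simp add: orthonormal_shifted_legendre_def)
    ultimately show ?thesis by (metis integrable_integral)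
  qed
  then have "((\<lambda>x. \<Sum>j<r. Re (a * cnj (\<alpha> j)) * (poly (P r) x * poly (P j) x))
               has_integral (\<Sum>j<r. Re (a * cnj (\<alpha> j)) * 0)) {0..1}"
    by (intro has_integral_sum has_integral_mult_right) auto
  moreover have "(\<Sum>j<r. Re (a * cnj (\<alpha> j)) * (poly (P r) x * poly (P j) x))
      = Re (a * of_real (poly (P r) x) * cnj (poly p (of_real x)))" for x
  proof -
    have "a * of_real (poly (P r) x) * cnj (poly p (of_real x))
        = (\<Sum>j<r. (a * cnj (\<alpha> j)) * of_real (poly (P r) x * poly (P j) x))"
      by (subst \<alpha>) (simp add: poly_sum sum_distrib_left mult_ac)
    then show ?thesis by (simp add: Re_sum)
  qed
  ultimately show ?thesis by simp
qed

lemma has_integral_deriv_norm_squared: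
  fixes w :: "complex poly"
  shows "((\<lambda>x. 2 * Re (poly w (of_real x) * cnj (poly (pderiv w) (of_real x))))
          has_integral ((cmod (poly w 1))\<^sup>2 - (cmod (poly w 0))\<^sup>2)) {0..1}"
proof -
  let ?f = "\<lambda>x::real. poly w (of_real x)" and ?f' = "\<lambda>x::real. poly (pderiv w) (of_real x)"
  have f: "(?f has_vector_derivative ?f' x) (at x within {0..1})" for x
    by (rule has_vector_derivative_real_field) simp
  have "((\<lambda>x. ?f x \<bullet> ?f x) has_vector_derivative (?f x \<bullet> ?f' x + ?f' x \<bullet> ?f x)) (at x within {0..1})"
    for x by (rule bounded_bilinear.has_vector_derivative[OF bounded_bilinear_inner f f])
  then have "((\<lambda>x. ?f x \<bullet> ?f' x + ?f' x \<bullet> ?f x) has_integral (?f 1 \<bullet> ?f 1 - ?f 0 \<bullet> ?f 0)) {0..1}"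
    by (intro fundamental_theorem_of_calculus) auto
  moreover have "(\<lambda>x. ?f x \<bullet> ?f' x + ?f' x \<bullet> ?f x) = (\<lambda>x. 2 * Re (?f x * cnj (?f' x)))"
    by (auto simp: inner_complex_def)
  ultimately show ?thesis
    by (simp add: power2_norm_eq_inner)
qed

text \<open>
  Real parts of \<open>w' = z (w - a P\<^sub>r)\<close> times \<open>cnj z \<cdot> cnj w'\<close> are integrated. The factor \<open>cnj z\<close>, in
  place of a division by \<open>z\<close>, keeps the identity valid at \<open>z = 0\<close>.
\<close>

lemma energy_identity:
  assumes P: "orthonormal_shifted_legendre P" and r: "1 \<le> r"
    and w: "legendre_perturbed_solution P r z w"
  shows "2 * Re z * integral {0..1} (\<lambda>x. (cmod (poly (pderiv w) (of_real x)))\<^sup>2)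
         = (cmod z)\<^sup>2 * ((cmod (poly w 1))\<^sup>2 - (cmod (poly w 0))\<^sup>2)"
proof -
  obtain a where a: "pderiv w = smult z (w - smult a (complex_poly (P r)))"
    and deg: "degree w \<le> r"
    using w by (auto simp: legendre_perturbed_solution_def)
  let ?f = "\<lambda>x::real. poly w (of_real x)" and ?f' = "\<lambda>x::real. poly (pderiv w) (of_real x)"
  let ?g = "\<lambda>x. 2 * Re z * (cmod (?f' x))\<^sup>2"
  have "((\<lambda>x. (cmod z)\<^sup>2 * (2 * Re (?f x * cnj (?f' x)))
          - 2 * (cmod z)\<^sup>2 * Re (a * of_real (poly (P r) x) * cnj (?f' x))) has_integral
         ((cmod z)\<^sup>2 * ((cmod (poly w 1))\<^sup>2 - (cmod (poly w 0))\<^sup>2) - 2 * (cmod z)\<^sup>2 * 0)) {0..1}"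
    by (intro has_integral_diff has_integral_mult_right has_integral_deriv_norm_squared
        integral_orthogonal[OF P] degree_pderiv_less[OF deg r])
  moreover have "(cmod z)\<^sup>2 * (2 * Re (?f x * cnj (?f' x)))
          - 2 * (cmod z)\<^sup>2 * Re (a * of_real (poly (P r) x) * cnj (?f' x)) = ?g x" for x
  proof -
    have f': "?f' x = z * (?f x - a * of_real (poly (P r) x))"
      by (subst a) simp
    have "of_real ((cmod z)\<^sup>2) * (?f x * cnj (?f' x) - a * of_real (poly (P r) x) * cnj (?f' x))
        = cnj z * (z * (?f x - a * of_real (poly (P r) x)) * cnj (?f' x))"
      unfolding complex_norm_square by (simp only: algebra_simps)
    also have "\<dots> = cnj z * (?f' x * cnj (?f' x))"
      by (simp only: f'[symmetric])
    also have "\<dots> = cnj z * of_real ((cmod (?f' x))\<^sup>2)"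
      by (simp only: complex_norm_square)
    finally have "Re (of_real ((cmod z)\<^sup>2) * (?f x * cnj (?f' x) - a * of_real (poly (P r) x) * cnj (?f' x)))
        = Re (cnj z * of_real ((cmod (?f' x))\<^sup>2))" by simp
    then have "(cmod z)\<^sup>2 * (Re (?f x * cnj (?f' x)) - Re (a * of_real (poly (P r) x) * cnj (?f' x)))
        = Re z * (cmod (?f' x))\<^sup>2"
      by (simp only: times_complex.sel minus_complex.sel Re_complex_of_real Im_complex_of_real cnj.sel)
    then show ?thesis by (simp add: algebra_simps)
  qed
  ultimately have "(?g has_integral
         ((cmod z)\<^sup>2 * ((cmod (poly w 1))\<^sup>2 - (cmod (poly w 0))\<^sup>2))) {0..1}"
    by simp
  from integral_unique[OF this] show ?thesis
    by (simp only: integral_mult_right)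
qed

lemma integral_norm_squared_pos:
  fixes p :: "complex poly"
  assumes "p \<noteq> 0"
  shows "0 < integral {0..1} (\<lambda>x. (cmod (poly p (of_real x)))\<^sup>2)"
proof -
  have cont: "continuous_on {0..1} (\<lambda>x. (cmod (poly p (of_real x)))\<^sup>2)"
    by (intro continuous_intros)
  have "integral {0..1} (\<lambda>x. (cmod (poly p (of_real x)))\<^sup>2) \<noteq> 0"
  proof
    assume "integral {0..1} (\<lambda>x. (cmod (poly p (of_real x)))\<^sup>2) = 0"
    then have "\<forall>x\<in>{0..1}. (cmod (poly p (of_real x)))\<^sup>2 = 0"
      using integral_eq_0_iff[OF cont] by simp
    then have "complex_of_real ` {0..1} \<subseteq> {x. poly p x = 0}" by auto
    moreover have "infinite (complex_of_real ` {0..1})"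
      by (subst finite_image_iff) (auto intro: inj_onI)
    ultimately show False
      using poly_roots_finite[OF assms] finite_subset by blast
  qed
  moreover have "0 \<le> integral {0..1} (\<lambda>x. (cmod (poly p (of_real x)))\<^sup>2)"
    by (intro integral_nonneg integrable_continuous_real cont) auto
  ultimately show ?thesis by simp
qed

text \<open>
  A constant solution would be a multiple of \<open>P\<^sub>r\<close>, whose degree is positive. This is what makes the
  contraction in the left half plane strict.
\<close>

lemma pderiv_solution_nonzero:
  assumes P: "orthonormal_shifted_legendre P" and r: "1 \<le> r" and z: "z \<noteq> 0"
    and w: "legendre_perturbed_solution P r z w" and "w \<noteq> 0"
  shows "pderiv w \<noteq> 0"
proof
  assume d: "pderiv w = 0"
  then obtain a where "w = smult a (complex_poly (P r))"
    using w z by (auto simp: legendre_perturbed_solution_def)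
  moreover from this have "a \<noteq> 0" using \<open>w \<noteq> 0\<close> by auto
  ultimately have "degree w = r"
    using P by (simp add: orthonormal_shifted_legendre_def)
  with d r show False by (simp add: pderiv_eq_0_iff)
qed

lemma strict_contraction:
  assumes P: "orthonormal_shifted_legendre P" and r: "1 \<le> r" and z: "Re z < 0"
    and w: "legendre_perturbed_solution P r z w" and "w \<noteq> 0"
  shows "cmod (poly w 1) < cmod (poly w 0)"
proof -
  have z0: "z \<noteq> 0" using z by auto
  have "2 * Re z * integral {0..1} (\<lambda>x. (cmod (poly (pderiv w) (of_real x)))\<^sup>2) < 0"
    using integral_norm_squared_pos[OF pderiv_solution_nonzero[OF P r z0 w \<open>w \<noteq> 0\<close>]] z
    by (simp add: mult_neg_pos)
  then have "(cmod (poly w 1))\<^sup>2 < (cmod (poly w 0))\<^sup>2"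
    using energy_identity[OF P r w] by (simp add: mult_less_0_iff)
  then show ?thesis by (rule power2_less_imp_less) simp
qed

text \<open>
  At \<open>z = 0\<close> the energy identity degenerates to \<open>0 = 0\<close>, but there \<open>w\<close> is constant.
\<close>

lemma no_contraction:
  assumes P: "orthonormal_shifted_legendre P" and r: "1 \<le> r" and z: "0 \<le> Re z"
    and w: "legendre_perturbed_solution P r z w"
  shows "cmod (poly w 0) \<le> cmod (poly w 1)"
proof (cases "z = 0")
  case True
  then have "pderiv w = 0" using w by (auto simp: legendre_perturbed_solution_def)
  then obtain d where "w = [:d:]" by (metis degree_eq_zeroE pderiv_eq_0_iff)
  then show ?thesis by simp
next
  case False
  have "0 \<le> 2 * Re z * integral {0..1} (\<lambda>x. (cmod (poly (pderiv w) (of_real x)))\<^sup>2)"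
    by (intro mult_nonneg_nonneg integral_nonneg integrable_continuous_real continuous_intros)
       (use z in auto)
  then have "(cmod (poly w 0))\<^sup>2 \<le> (cmod (poly w 1))\<^sup>2"
    using energy_identity[OF P r w] False by (simp add: zero_le_mult_iff)
  then show ?thesis by (rule power2_le_imp_le) simp
qed

section \<open>Existence and uniqueness\<close>

lemma smult_sum_right: "smult a (\<Sum>i\<in>S. f i) = (\<Sum>i\<in>S. smult a (f i))"
  by (induction S rule: infinite_finite_induct) (simp_all add: smult_add_right)

lemma solution_smult:
  assumes "legendre_perturbed_solution P r z w"
  shows "legendre_perturbed_solution P r z (smult s w)"
proof -
  obtain a where a: "pderiv w = smult z (w - smult a (complex_poly (P r)))"
    and deg: "degree w \<le> r"
    using assms by (auto simp: legendre_perturbed_solution_def)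
  have "pderiv (smult s w) = smult z (smult s w - smult (s * a) (complex_poly (P r)))"
    by (simp add: pderiv_smult a smult_diff_right mult_ac)
  then show ?thesis
    using deg le_trans[OF degree_smult_le] by (auto simp: legendre_perturbed_solution_def)
qed

lemma solution_diff:
  assumes "legendre_perturbed_solution P r z v" and "legendre_perturbed_solution P r z w"
  shows "legendre_perturbed_solution P r z (v - w)"
proof -
  obtain a b where a: "pderiv v = smult z (v - smult a (complex_poly (P r)))"
    and b: "pderiv w = smult z (w - smult b (complex_poly (P r)))"
    and deg: "degree v \<le> r" "degree w \<le> r"
    using assms by (auto simp: legendre_perturbed_solution_def)
  have "pderiv (v - w) = smult z (v - w - smult (a - b) (complex_poly (P r)))"
    by (simp add: pderiv_diff a b smult_diff_right smult_diff_left)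
  then show ?thesis
    using deg degree_diff_le by (auto simp: legendre_perturbed_solution_def)
qed

text \<open>
  With \<open>D\<close> for the derivative, the equation with \<open>a = 1\<close> reads \<open>(1 - D / z) w = P\<^sub>r\<close>. On polynomials \<open>D\<close> is
  nilpotent, so the Neumann series of \<open>1 - D / z\<close> is a finite sum and gives \<open>w\<close>.
\<close>

lemma nonzero_solution_exists:
  assumes P: "orthonormal_shifted_legendre P" and r: "1 \<le> r" and z: "z \<noteq> 0"
  shows "\<exists>w. w \<noteq> 0 \<and> legendre_perturbed_solution P r z w"
proof -
  let ?L = "complex_poly (P r)"
  have degL: "degree ?L = r"
    using P by (simp add: orthonormal_shifted_legendre_def)
  define w where "w = (\<Sum>n\<le>r. smult (inverse z ^ n) ((pderiv ^^ n) ?L))"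
  have "degree ((pderiv ^^ Suc r) ?L) = 0" "coeff ((pderiv ^^ Suc r) ?L) 0 = 0"
    using degL by (simp_all only: degree_higher_pderiv coeff_higher_pderiv) (simp_all add: coeff_eq_0)
  then have top: "(pderiv ^^ Suc r) ?L = 0"
    by (metis leading_coeff_0_iff)
  have "pderiv w = (\<Sum>n\<le>r. smult (inverse z ^ n) ((pderiv ^^ Suc n) ?L))"
    by (simp add: w_def pderiv_smult higher_pderiv_sum[of 1, simplified])
  also have "\<dots> = smult z (\<Sum>n\<le>r. smult (inverse z ^ Suc n) ((pderiv ^^ Suc n) ?L))"
    by (simp only: smult_sum_right smult_smult power_Suc mult.assoc[symmetric] right_inverse[OF z] mult_1_left)
  also have "(\<Sum>n\<le>r. smult (inverse z ^ Suc n) ((pderiv ^^ Suc n) ?L))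
     = (\<Sum>n\<le>Suc r. smult (inverse z ^ n) ((pderiv ^^ n) ?L)) - ?L"
    by (subst sum.atMost_Suc_shift) simp
  also have "\<dots> = w - smult 1 ?L"
    unfolding w_def sum.atMost_Suc top by simp
  finally have eq: "pderiv w = smult z (w - smult 1 ?L)" .
  have "degree w \<le> r"
    unfolding w_def
    by (intro degree_sum_le) (auto intro!: le_trans[OF degree_smult_le] simp: degree_higher_pderiv degL[simplified])
  with eq have "legendre_perturbed_solution P r z w"
    unfolding legendre_perturbed_solution_def by blast
  moreover have "w \<noteq> 0"
  proof
    assume "w = 0"
    with eq z have "?L = 0" by simp
    with degL r show False by simp
  qed
  ultimately show ?thesis by blast
qed

text \<open>
  Since \<open>|w(1)| < |w(0)|\<close> for every nonzero solution when \<open>Re z < 0\<close>, \<open>w \<mapsto> w(0)\<close> is injective on solutions; and it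
  is onto because it is not zero at some solution.
\<close>

lemma solution_ex1:
  assumes P: "orthonormal_shifted_legendre P" and r: "1 \<le> r" and z: "Re z < 0"
  shows "\<exists>!w. legendre_perturbed_solution P r z w \<and> poly w 0 = y0"
proof (rule ex_ex1I)
  have "z \<noteq> 0" using z by auto
  then obtain v where v: "v \<noteq> 0" "legendre_perturbed_solution P r z v"
    using nonzero_solution_exists[OF P r] by blast
  then have "poly v 0 \<noteq> 0"
    using strict_contraction[OF P r z] by fastforce
  then show "\<exists>w. legendre_perturbed_solution P r z w \<and> poly w 0 = y0"
    using solution_smult[OF v(2)] by (intro exI[of _ "smult (y0 / poly v 0) v"]) simp
next
  fix v w
  assume "legendre_perturbed_solution P r z v \<and> poly v 0 = y0"
    and "legendre_perturbed_solution P r z w \<and> poly w 0 = y0"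
  then have "legendre_perturbed_solution P r z (v - w)" "poly (v - w) 0 = 0"
    using solution_diff by auto
  then have "v - w = 0"
    using strict_contraction[OF P r z, of "v - w"] by fastforce
  then show "v = w" by simp
qed

section \<open>Reduction to the unit step and stability\<close>

definition rescale :: "real \<Rightarrow> real \<Rightarrow> complex poly \<Rightarrow> complex poly" where
  "rescale t0 h u = pcompose u [:of_real t0, of_real h:]"

lemma poly_rescale: "poly (rescale t0 h u) (of_real s) = poly u (of_real (t0 + s * h))"
  by (simp add: rescale_def poly_pcompose mult.commute)

lemma bij_rescale:
  assumes "h > 0"
  shows "bij (rescale t0 h)"
proof (rule o_bij)
  show "rescale (- t0 / h) (1 / h) \<circ> rescale t0 h = id"
    using assms by (auto simp: fun_eq_iff rescale_def pcompose_assoc[symmetric] pcompose_pCons)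
  show "rescale t0 h \<circ> rescale (- t0 / h) (1 / h) = id"
    using assms by (auto simp: fun_eq_iff rescale_def pcompose_assoc[symmetric] pcompose_pCons)
qed

lemma method_polynomial_rescale:
  assumes h: "h > 0" and z: "z = of_real h * \<mu>"
  shows "method_polynomial P k r c b (\<lambda>y. \<mu> * y) t0 y0 h u \<longleftrightarrow>
         method_polynomial P k r c b (\<lambda>y. z * y) 0 y0 1 (rescale t0 h u)"
proof -
  have deg: "degree (rescale t0 h u) = degree u"
    using h by (simp add: rescale_def degree_pcompose)
  have p0: "poly (rescale t0 h u) 0 = poly u (of_real t0)"
    using poly_rescale[of t0 h u 0] by simp
  have d: "poly (pderiv (rescale t0 h u)) (of_real s) = of_real h * poly (pderiv u) (of_real (t0 + s * h))"
    for s
    by (simp add: rescale_def pderiv_pcompose poly_pcompose pderiv_pCons mult.commute)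
  have s: "(\<Sum>j<r. of_real (poly (P j) x) *
           (\<Sum>l=1..k. of_real (b l * poly (P j) (c l)) * (z * y l)))
     = of_real h * (\<Sum>j<r. of_real (poly (P j) x) *
           (\<Sum>l=1..k. of_real (b l * poly (P j) (c l)) * (\<mu> * y l)))" for x and y :: "nat \<Rightarrow> complex"
    by (simp add: z sum_distrib_left mult_ac)
  show ?thesis
    using h unfolding method_polynomial_def add_0 mult_1_right poly_rescale d s deg
    by (simp add: p0)
qed

theorem corollary3:
  fixes P :: "nat \<Rightarrow> real poly"
    and k r q :: nat
    and c b :: "nat \<Rightarrow> real"
  assumes "orthonormal_shifted_legendre P"
    and "1 \<le> r" and "r \<le> k"
    and "inj_on c {1..k}"
    and "\<forall>i\<in>{1..k}. c i \<in> {0..1}"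
    and "k \<le> q"
    and "quadrature_order k c b q"
    and "2 * r \<le> q"
  shows "perfectly_A_stable P k r c b"
proof -
  have method_iff: "method_polynomial P k r c b (\<lambda>y. \<mu> * y) t0 y0 h u \<longleftrightarrow>
      legendre_perturbed_solution P r z (rescale t0 h u) \<and> poly (rescale t0 h u) 0 = y0"
    if "h > 0" "z = of_real h * \<mu>" for z \<mu> :: complex and t0 h y0 u
    unfolding method_polynomial_rescale[OF that]
    by (rule unit_step_iff) (use assms in auto)
  have endpoint: "poly u (of_real (t0 + h)) = poly (rescale t0 h u) 1" for t0 h u
    using poly_rescale[of t0 h u 1] by simp
  have "z \<in> absolute_stability_region P k r c b \<longleftrightarrow> Re z < 0" for z
  proof
    assume neg: "Re z < 0"
    note ex1 = solution_ex1[OF assms(1,2) neg]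
    have unique: "uniquely_determined P k r c b z"
      unfolding uniquely_determined_def
    proof (intro allI impI, elim conjE)
      fix t0 h :: real and y0 \<mu> :: complex
      assume h: "h > 0" "z = of_real h * \<mu>"
      show "\<exists>!u. method_polynomial P k r c b (\<lambda>y. \<mu> * y) t0 y0 h u"
        unfolding method_iff[OF h]
        using ex1[of y0] bij_rescale[OF h(1), of t0] by (metis bij_pointE)
    qed
    obtain w where w: "legendre_perturbed_solution P r z w" "poly w 0 = 1"
      using ex1[of 1] by blast
    have "stability_value P k r c b z (poly w 1)"
      unfolding stability_value_def
    proof (intro allI impI, elim conjE)
      fix t0 h :: real and y0 \<mu> :: complex and u
      assume h: "h > 0" "z = of_real h * \<mu>"
        and "method_polynomial P k r c b (\<lambda>y. \<mu> * y) t0 y0 h u"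
      then have "legendre_perturbed_solution P r z (rescale t0 h u)" "poly (rescale t0 h u) 0 = y0"
        using method_iff by blast+
      moreover have "legendre_perturbed_solution P r z (smult y0 w)" "poly (smult y0 w) 0 = y0"
        using solution_smult[OF w(1)] w(2) by simp_all
      ultimately have "rescale t0 h u = smult y0 w"
        using ex1[of y0] by blast
      then show "poly u (of_real (t0 + h)) = poly w 1 * y0"
        unfolding endpoint by simp
    qed
    moreover have "norm (poly w 1) < 1"
      using strict_contraction[OF assms(1,2) neg w(1)] w(2) by fastforce
    ultimately show "z \<in> absolute_stability_region P k r c b"
      using unique unfolding absolute_stability_region_def by blast
  next
    assume "z \<in> absolute_stability_region P k r c b"
    then obtain R where unique: "uniquely_determined P k r c b z"
      and R: "stability_value P k r c b z R" "norm R < 1"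
      unfolding absolute_stability_region_def by blast
    have h: "(1::real) > 0" "z = of_real 1 * z" by simp_all
    obtain u where u: "method_polynomial P k r c b (\<lambda>y. z * y) 0 1 1 u"
      using unique h unfolding uniquely_determined_def by blast
    let ?w = "rescale 0 1 u"
    have w: "legendre_perturbed_solution P r z ?w" "poly ?w 0 = 1"
      using u method_iff[OF h] by blast+
    have "poly u (of_real (0 + 1)) = R * 1"
      using R(1) h u unfolding stability_value_def by blast
    then have "poly ?w 1 = R"
      unfolding endpoint by simp
    then have "cmod (poly ?w 1) < cmod (poly ?w 0)"
      using R(2) w(2) by simp
    then show "Re z < 0"
      using no_contraction[OF assms(1,2) _ w(1)] by (metis linorder_not_less)
  qed
  then show ?thesis
    unfolding perfectly_A_stable_def by blast
qed

end
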